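(* Any nilpotent subgroup of $\mathrm{PL}(I)$ or $\mathrm{PL}(S^1)$ is abelian.
   Context: $I=[0,1]$ and $S^1$ is the circle. For $M=I$ or $S^1$, a piecewise linear homeomorphism of $M$ is a homeomorphism $f$ of $M$ such that $M$ is a union of finitely many subintervals on each of which $f$ is linear (i.e. affine; on $S^1=\mathbf{R}/\mathbf{Z}$ this is understood in the coordinate on $\mathbf{R}$). $\mathrm{PL}(M)$ denotes the group of orientation-preserving piecewise linear homeomorphisms of $M$, under composition. *)

theory Defs
  imports "HOL-Analysis.Analysis" "HOL-Algebra.Bij" "HOL-Algebra.Generated_Groups"
begin

section \<open>Nilpotent groups\<close>

primrec lower_central_series :: "('a, 'b) monoid_scheme \<Rightarrow> nat \<Rightarrow> 'a set" where
  "lower_central_series G 0 = carrier G"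
| "lower_central_series G (Suc n) =
     generate G {x \<otimes>\<^bsub>G\<^esub> y \<otimes>\<^bsub>G\<^esub> inv\<^bsub>G\<^esub> x \<otimes>\<^bsub>G\<^esub> inv\<^bsub>G\<^esub> y | x y.
       x \<in> lower_central_series G n \<and> y \<in> carrier G}"

definition nilpotent_group :: "('a, 'b) monoid_scheme \<Rightarrow> bool" where
  "nilpotent_group G \<longleftrightarrow> group G \<and> (\<exists>n. lower_central_series G n = {\<one>\<^bsub>G\<^esub>})"


section \<open>Piecewise linear homeomorphisms of the interval\<close>

text \<open>Homeomorphisms of \<open>M\<close> are represented as in \<^const>\<open>BijGroup\<close>: by functions that
  are undefined outside \<open>M\<close>, so that equality of functions is equality on \<open>M\<close>.\<close>

definition piecewise_linear_I :: "(real \<Rightarrow> real) \<Rightarrow> bool" where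
  "piecewise_linear_I f \<longleftrightarrow>
     (\<exists>P. finite P \<and> (\<forall>J\<in>P. is_interval J) \<and> \<Union>P = {0..1} \<and>
          (\<forall>J\<in>P. \<exists>a b. \<forall>t\<in>J. f t = a * t + b))"

definition PL_I :: "(real \<Rightarrow> real) monoid" where
  "PL_I = (BijGroup {0..1})
     \<lparr>carrier := {f \<in> Bij {0..1}. (\<exists>g. homeomorphism {0..1} {0..1} f g) \<and>
                   strict_mono_on {0..1} f \<and> piecewise_linear_I f}\<rparr>"


section \<open>Piecewise linear homeomorphisms of the circle\<close>

text \<open>The circle is the unit circle of the complex plane, identified with the quotient of
  the reals by the integers through the following covering map.\<close>

abbreviation circle :: "complex set" where
  "circle \<equiv> sphere 0 1"

definition circle_coord :: "real \<Rightarrow> complex" where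
  "circle_coord t = cis (2 * pi * t)"

text \<open>Subintervals of the circle are images of real intervals, and linearity on them refers
  to the coordinate on the reals (the translation part is determined up to an integer).\<close>

definition piecewise_linear_circle :: "(complex \<Rightarrow> complex) \<Rightarrow> bool" where
  "piecewise_linear_circle f \<longleftrightarrow>
     (\<exists>P. finite P \<and> (\<forall>J\<in>P. is_interval J) \<and> (\<Union>J\<in>P. circle_coord ` J) = circle \<and>
          (\<forall>J\<in>P. \<exists>a b. \<forall>t\<in>J. f (circle_coord t) = circle_coord (a * t + b)))"

text \<open>A homeomorphism of the circle preserves orientation iff it has an increasing lift to
  the reals.\<close>

definition orientation_preserving_circle :: "(complex \<Rightarrow> complex) \<Rightarrow> bool" where
  "orientation_preserving_circle f \<longleftrightarrow>
     (\<exists>F :: real \<Rightarrow> real. continuous_on UNIV F \<and> strict_mono F \<and>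
        (\<forall>t. f (circle_coord t) = circle_coord (F t)))"

definition PL_circle :: "(complex \<Rightarrow> complex) monoid" where
  "PL_circle = (BijGroup circle)
     \<lparr>carrier := {f \<in> Bij circle. (\<exists>g. homeomorphism circle circle f g) \<and>
                   orientation_preserving_circle f \<and> piecewise_linear_circle f}\<rparr>"

end

theory Submission
  imports Defs
begin

text \<open>If a nilpotent group is not abelian, it contains \<open>x\<close>, \<open>y\<close> whose commutator \<open>h \<noteq> 1\<close> commutes with both.
  On the interval, \<open>x\<close>, \<open>y\<close> and \<open>h\<close> fix the infimum \<open>a\<close> of the points moved by \<open>h\<close>; right slopes at \<open>a\<close>
  multiply, so \<open>h\<close> has slope one there, and being locally affine it is the identity to the right of \<open>a\<close>,
  a contradiction. On the circle, choose lifts \<open>X\<close>, \<open>Y\<close> and \<open>F = [X, Y]\<close>, which still commutes with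
  \<open>X\<close> and \<open>Y\<close>. Since \<open>F\<^sup>n\<^sup>n = [X\<^sup>n, Y\<^sup>n]\<close> moves points by less than 2 for all \<open>n\<close>, \<open>F\<close> has a fixed point.
  The fixed points \<open>a\<close> at which \<open>F\<close> is not the identity on the right are finitely many modulo the integers and
  permuted by \<open>X\<close> and \<open>Y\<close>, so some \<open>X\<^sup>p\<close> and \<open>Y\<^sup>r\<close>, corrected by translations, fix \<open>a\<close>. Their commutator is
  \<open>F\<^sup>p\<^sup>r\<close>, hence has slope one at \<open>a\<close>, and again \<open>F\<close> is the identity to the right of \<open>a\<close>.\<close>

section \<open>Central commutators in nilpotent groups\<close>

context group
begin

lemma lower_central_series_subset: "lower_central_series G n \<subseteq> carrier G"
proof (induction n)
  case (Suc n)
  have "{x \<otimes> y \<otimes> inv x \<otimes> inv y | x y. x \<in> lower_central_series G n \<and> y \<in> carrier G} \<subseteq> carrier G"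
    using Suc by auto
  then show ?case
    by (simp add: generate_incl)
qed simp

lemma commutator_eq_iff:
  assumes "x \<in> carrier G" "y \<in> carrier G" "h \<in> carrier G"
  shows "x \<otimes> y \<otimes> inv x \<otimes> inv y = h \<longleftrightarrow> x \<otimes> y = h \<otimes> y \<otimes> x"
  using assms by (metis inv_solve_right m_closed inv_closed)

text \<open>A commutator \<open>h\<close> of some \<open>x\<close> in term \<open>n\<close> with any
  \<open>y\<close> lies in term \<open>n + 1\<close>, and its own commutators lie in the trivial
  term \<open>n + 2\<close>, so \<open>h\<close> is central. The first hypothesis then makes every
  generator of term \<open>n + 1\<close> trivial.\<close>

lemma lower_central_series_descend:
  assumes central: "\<And>x y h. \<lbrakk>x \<in> carrier G; y \<in> carrier G; h \<in> carrier G; x \<otimes> y = h \<otimes> y \<otimes> x;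
      h \<otimes> x = x \<otimes> h; h \<otimes> y = y \<otimes> h\<rbrakk> \<Longrightarrow> h = \<one>"
    and "lower_central_series G (Suc (Suc n)) = {\<one>}"
  shows "lower_central_series G (Suc n) = {\<one>}"
proof -
  have "x \<otimes> y \<otimes> inv x \<otimes> inv y = \<one>" if x: "x \<in> lower_central_series G n" and y: "y \<in> carrier G" for x y
  proof -
    define h where "h = x \<otimes> y \<otimes> inv x \<otimes> inv y"
    have xG: "x \<in> carrier G"
      using x lower_central_series_subset by blast
    have hL: "h \<in> lower_central_series G (Suc n)"
      unfolding h_def using x y by (auto intro!: generate.incl)
    have hG: "h \<in> carrier G"
      using hL lower_central_series_subset by blast
    have comm: "h \<otimes> z = z \<otimes> h" if z: "z \<in> carrier G" for z
    proof -
      have "h \<otimes> z \<otimes> inv h \<otimes> inv z \<in> lower_central_series G (Suc (Suc n))"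
        using hL z by (subst lower_central_series.simps(2)) (blast intro: generate.incl)
      then have "h \<otimes> z \<otimes> inv h \<otimes> inv z = \<one>"
        using assms(2) by simp
      then show ?thesis
        using commutator_eq_iff[OF hG z one_closed] hG z by simp
    qed
    have "x \<otimes> y = h \<otimes> y \<otimes> x"
      using commutator_eq_iff[OF xG y hG] h_def by simp
    then show ?thesis
      using central[OF xG y hG] comm xG y h_def by simp
  qed
  then have "{x \<otimes> y \<otimes> inv x \<otimes> inv y | x y. x \<in> lower_central_series G n \<and> y \<in> carrier G} \<subseteq> {\<one>}"
    by auto
  then have "lower_central_series G (Suc n) \<subseteq> generate G {\<one>}"
    unfolding lower_central_series.simps by (rule mono_generate)
  also have "generate G {\<one>} \<subseteq> {\<one>}"
    using generate_subgroup_incl[OF _ triv_subgroup] by simp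
  finally show ?thesis
    using generate.one by fastforce
qed

lemma nilpotent_comm_groupI:
  assumes "nilpotent_group G"
    and central: "\<And>x y h. \<lbrakk>x \<in> carrier G; y \<in> carrier G; h \<in> carrier G; x \<otimes> y = h \<otimes> y \<otimes> x;
      h \<otimes> x = x \<otimes> h; h \<otimes> y = y \<otimes> h\<rbrakk> \<Longrightarrow> h = \<one>"
  shows "comm_group G"
proof -
  obtain n where n: "lower_central_series G n = {\<one>}"
    using assms(1) unfolding nilpotent_group_def by blast
  \<comment> \<open>The descent stops at term 1, the subgroup generated by all commutators, because
    term 0 is the whole group.\<close>
  have *: "lower_central_series G (Suc n) = {\<one>} \<Longrightarrow> lower_central_series G (Suc 0) = {\<one>}" for n
  proof (induction n)
    case (Suc n)
    have "lower_central_series G (Suc n) = {\<one>}"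
      by (rule lower_central_series_descend) (fact central, fact Suc.prems)
    then show ?case
      by (rule Suc.IH)
  qed
  have comm: "x \<otimes> y = y \<otimes> x" if xy: "x \<in> carrier G" "y \<in> carrier G" for x y
  proof (cases n)
    case 0
    then show ?thesis
      using n xy by simp
  next
    case (Suc m)
    then have "lower_central_series G (Suc 0) = {\<one>}"
      using * n by blast
    moreover have "x \<otimes> y \<otimes> inv x \<otimes> inv y \<in> lower_central_series G (Suc 0)"
      using xy by (auto intro!: generate.incl)
    ultimately have "x \<otimes> y \<otimes> inv x \<otimes> inv y = \<one>"
      by blast
    then show ?thesis
      using commutator_eq_iff xy by simp
  qed
  show ?thesis
    by (rule group_comm_groupI) (rule comm)
qed

end

text \<open>Products in \<open>BijGroup S\<close> are compositions restricted to \<open>S\<close>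
  and its elements are extensional, so the group equations become pointwise ones. This form serves
  both the interval and the circle.\<close>

lemma nilpotent_comm_group_of_bijections:
  assumes H: "H \<subseteq> Bij S"
    and nil: "nilpotent_group ((BijGroup S)\<lparr>carrier := H\<rparr>)"
    and central: "\<And>x y h t. \<lbrakk>x \<in> H; y \<in> H; h \<in> H; \<And>t. t \<in> S \<Longrightarrow> x (y t) = h (y (x t));
      \<And>t. t \<in> S \<Longrightarrow> h (x t) = x (h t); \<And>t. t \<in> S \<Longrightarrow> h (y t) = y (h t); t \<in> S\<rbrakk> \<Longrightarrow> h t = t"
  shows "comm_group ((BijGroup S)\<lparr>carrier := H\<rparr>)"
proof -
  interpret group "(BijGroup S)\<lparr>carrier := H\<rparr>"
    using nil unfolding nilpotent_group_def by blast
  have mult: "x \<otimes>\<^bsub>BijGroup S\<^esub> y = compose S x y" if "x \<in> H" "y \<in> H" for x y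
    using that H by (auto simp: BijGroup_def)
  show ?thesis
  proof (rule nilpotent_comm_groupI[OF nil])
    fix x y h
    let ?m = "mult ((BijGroup S)\<lparr>carrier := H\<rparr>)"
    assume "x \<in> carrier ((BijGroup S)\<lparr>carrier := H\<rparr>)" "y \<in> carrier ((BijGroup S)\<lparr>carrier := H\<rparr>)"
      "h \<in> carrier ((BijGroup S)\<lparr>carrier := H\<rparr>)"
    then have xyh: "x \<in> H" "y \<in> H" "h \<in> H"
      by auto
    assume eqs: "?m x y = ?m (?m h y) x" "?m h x = ?m x h" "?m h y = ?m y h"
    have hyH: "compose S h y \<in> H"
      using m_closed[of h y] mult xyh by simp
    have maps: "f t \<in> S" if "f \<in> H" "t \<in> S" for f t
      using that H Bij_imp_funcset by blast
    have ap: "compose S f g t = f (g t)" if "t \<in> S" for f g :: "'a \<Rightarrow> 'a" and t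
      using that by (simp add: compose_def)
    have "compose S x y = compose S (compose S h y) x"
      using eqs(1) xyh hyH by (simp add: mult)
    then have 1: "x (y t) = h (y (x t))" if "t \<in> S" for t
      using ap that maps xyh by metis
    have "compose S h x = compose S x h" "compose S h y = compose S y h"
      using eqs(2,3) xyh by (simp_all add: mult)
    then have 2: "h (x t) = x (h t)" "h (y t) = y (h t)" if "t \<in> S" for t
      using ap that by metis+
    have "h t = t" if "t \<in> S" for t
      by (rule central[of x y h]) (use xyh 1 2 that in auto)
    moreover have "h \<in> extensional S"
      using xyh H by (auto simp: Bij_def)
    ultimately have "h = (\<lambda>t\<in>S. t)"
      by (auto intro: extensionalityI)
    then show "h = \<one>\<^bsub>(BijGroup S)\<lparr>carrier := H\<rparr>\<^esub>"
      by (simp add: BijGroup_def)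
  qed
qed

section \<open>Germs at the right of a point\<close>

text \<open>The germ is exactly affine, not merely differentiable, so that slope one at a fixed
  point means the identity nearby. Positivity keeps right neighbourhoods on the right and lets
  slopes be cancelled.\<close>

definition right_slope :: "(real \<Rightarrow> real) \<Rightarrow> real \<Rightarrow> real \<Rightarrow> bool" where
  "right_slope f a m \<longleftrightarrow> 0 < m \<and> (\<forall>\<^sub>F s in at_right a. f s = f a + m * (s - a))"

text \<open>The affine formula is given only to the right of \<open>a\<close>; continuity from the
  right fixes its value at \<open>a\<close>, and \<open>gt\<close> fixes the sign of the
  slope.\<close>

lemma right_slopeI:
  assumes "(f \<longlongrightarrow> f a) (at_right a)" "\<forall>\<^sub>F s in at_right a. f s = m * s + b"
    and gt: "\<forall>\<^sub>F s in at_right a. f a < f s"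
  shows "right_slope f a m"
proof -
  have "((\<lambda>s. m * s + b) \<longlongrightarrow> m * a + b) (at_right a)"
    by (intro tendsto_intros)
  then have "(f \<longlongrightarrow> m * a + b) (at_right a)"
    using assms(2) by (subst filterlim_cong[OF refl refl]) auto
  with assms(1) have b: "f a = m * a + b"
    using tendsto_unique trivial_limit_at_right_real by blast
  have *: "\<forall>\<^sub>F s in at_right a. f s = f a + m * (s - a)"
    using assms(2) by eventually_elim (simp add: b algebra_simps)
  have "\<forall>\<^sub>F s in at_right a. 0 < m"
    using * gt eventually_at_right_less[of a] by eventually_elim (simp add: zero_less_mult_iff)
  then have "0 < m"
    by simp
  then show ?thesis
    using * unfolding right_slope_def by blast
qed

lemma right_slope_filterlim:
  assumes "right_slope f a m"
  shows "filterlim f (at_right (f a)) (at_right a)"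
  unfolding filterlim_at
proof
  have m: "0 < m" and f: "\<forall>\<^sub>F s in at_right a. f s = f a + m * (s - a)"
    using assms unfolding right_slope_def by auto
  show "\<forall>\<^sub>F s in at_right a. f s \<in> {f a<..} \<and> f s \<noteq> f a"
    using f eventually_at_right_less[of a] by eventually_elim (use m in simp)
  have "((\<lambda>s. f a + m * (s - a)) \<longlongrightarrow> f a + m * (a - a)) (at_right a)"
    by (intro tendsto_intros)
  then show "(f \<longlongrightarrow> f a) (at_right a)"
    using f by (subst filterlim_cong[OF refl refl]) auto
qed

lemma right_slope_compose:
  assumes f: "right_slope f a m" and g: "right_slope g (f a) n"
  shows "right_slope (\<lambda>s. g (f s)) a (n * m)"
proof -
  have "\<forall>\<^sub>F s in at_right a. g (f s) = g (f a) + n * (f s - f a)"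
    by (rule eventually_compose_filterlim[OF _ right_slope_filterlim[OF f]])
       (use g in \<open>simp add: right_slope_def\<close>)
  moreover have "\<forall>\<^sub>F s in at_right a. f s = f a + m * (s - a)"
    using f unfolding right_slope_def by blast
  ultimately have "\<forall>\<^sub>F s in at_right a. g (f s) = g (f a) + n * m * (s - a)"
    by eventually_elim simp
  then show ?thesis
    using f g unfolding right_slope_def by simp
qed

lemma right_slope_unique:
  assumes "right_slope f a m" "right_slope g a n" "\<forall>\<^sub>F s in at_right a. f s = g s" "f a = g a"
  shows "m = n"
proof -
  have "\<forall>\<^sub>F s in at_right a. f s = f a + m * (s - a)" "\<forall>\<^sub>F s in at_right a. g s = g a + n * (s - a)"
    using assms unfolding right_slope_def by auto
  then have "\<forall>\<^sub>F s in at_right a. m = n"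
    using assms(3) eventually_at_right_less[of a] by eventually_elim (use assms(4) in auto)
  then show ?thesis
    by simp
qed

text \<open>Slopes at a common fixed point multiply, so a commutator has slope one.\<close>

lemma right_slope_commutator:
  assumes f: "right_slope f a m" "f a = a" and g: "right_slope g a n" "g a = a"
    and h: "right_slope h a l" "h a = a"
    and comm: "\<forall>\<^sub>F s in at_right a. f (g s) = h (g (f s))"
  shows "l = 1"
proof -
  have "right_slope (\<lambda>s. f (g s)) a (m * n)"
    using right_slope_compose[OF g(1)] f g by simp
  moreover have "right_slope (\<lambda>s. h (g (f s))) a (l * (n * m))"
    using right_slope_compose[OF right_slope_compose[OF f(1)]] f g h by simp
  ultimately have "m * n = l * (n * m)"
    by (rule right_slope_unique) (use comm f g h in auto)
  then show ?thesis
    using f g unfolding right_slope_def by (simp add: algebra_simps)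
qed

lemma right_slope_one:
  assumes "right_slope f a 1" "f a = a"
  shows "\<forall>\<^sub>F s in at_right a. f s = s"
  using assms unfolding right_slope_def by simp

section \<open>Interval covers near a point\<close>

lemma finite_frontier_is_interval:
  fixes J :: "real set"
  assumes "is_interval J"
  shows "finite (frontier J)"
proof -
  obtain a b where "J = {} \<or> J = UNIV \<or> J = {..<b} \<or> J = {..b} \<or> J = {a<..} \<or> J = {a..} \<or>
      J = {a<..<b} \<or> J = {a<..b} \<or> J = {a..<b} \<or> J = {a..b}"
    using is_real_interval[OF assms] by blast
  then have "frontier J \<subseteq> {a, b}"
    by (elim disjE; simp add: frontier_def; cases a b rule: linorder_cases; auto simp: interior_open)
  then show ?thesis
    by (rule finite_subset) simp
qed

text \<open>Between \<open>a\<close> and the first frontier point after it, no interval of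
  \<open>Q\<close> starts or ends, so one that meets this stretch contains it by connectedness.
  \<open>Q\<close> itself may be infinite, as happens with integer translates.\<close>

lemma interval_cover_at_right:
  fixes a c :: real
  assumes "a < c" and int: "\<And>J. J \<in> Q \<Longrightarrow> is_interval J"
    and cover: "{a<..<c} \<subseteq> \<Union>Q" and fin: "finite ({a<..<c} \<inter> \<Union>(frontier ` Q))"
  obtains J where "J \<in> Q" "\<forall>\<^sub>F s in at_right a. s \<in> J"
proof -
  let ?D = "{a<..<c} \<inter> \<Union>(frontier ` Q)"
  \<comment> \<open>Inserting \<open>c\<close> supplies a value when there is no frontier
    point.\<close>
  define d where "d = Min (insert c ?D)"
  have d: "a < d" "d \<le> c" and dD: "\<And>t. t \<in> ?D \<Longrightarrow> d \<le> t"
    using fin \<open>a < c\<close> unfolding d_def by auto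
  have "(a + d) / 2 \<in> {a<..<c}"
    using d by auto
  then obtain J where J: "J \<in> Q" "(a + d) / 2 \<in> J"
    using cover by blast
  have "{a<..<d} \<inter> frontier J = {}"
    using dD J(1) d by fastforce
  moreover have "{a<..<d} \<inter> J \<noteq> {}"
    using J(2) d by (auto simp: disjoint_iff intro!: exI[of _ "(a + d) / 2"])
  ultimately have "{a<..<d} - J = {}"
    using connected_Int_frontier[OF connected_Ioo] by blast
  then have "\<forall>\<^sub>F s in at_right a. s \<in> J"
    using eventually_at_right_real[OF d(1)] by (elim eventually_mono) auto
  then show ?thesis
    using that J(1) by blast
qed

section \<open>The interval\<close>

lemma PL_I_right_slope:
  assumes f: "f \<in> carrier PL_I" and a: "0 \<le> a" "a < 1"
  obtains m where "right_slope f a m"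
proof -
  have cont: "continuous_on {0..1} f" and mono: "strict_mono_on {0..1} f" and "piecewise_linear_I f"
    using f by (auto simp: PL_I_def homeomorphism_def)
  then obtain P where P: "finite P" "\<forall>J\<in>P. is_interval J" "\<Union>P = {0..1}"
      "\<forall>J\<in>P. \<exists>m b. \<forall>t\<in>J. f t = m * t + b"
    unfolding piecewise_linear_I_def by (elim exE conjE)
  obtain J where J: "J \<in> P" "\<forall>\<^sub>F s in at_right a. s \<in> J"
  proof (rule interval_cover_at_right[OF a(2)])
    show "finite ({a<..<1} \<inter> \<Union>(frontier ` P))"
      using P(1,2) finite_frontier_is_interval by blast
    show "{a<..<1} \<subseteq> \<Union>P"
      using P(3) a by auto
  qed (use P(2) in auto)
  obtain m b where mb: "\<forall>t\<in>J. f t = m * t + b"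
    using P(4) J(1) by metis
  have near: "\<forall>\<^sub>F s in at_right a. s \<in> {0..1} \<and> a < s"
    using eventually_at_right_real[OF a(2)] by eventually_elim (use a in auto)
  have "right_slope f a m"
  proof (rule right_slopeI)
    have "(f \<longlongrightarrow> f a) (at a within {0..1})"
      using cont a unfolding continuous_on_def by auto
    then have "(f \<longlongrightarrow> f a) (at a within {a..1})"
      by (rule tendsto_within_subset) (use a in auto)
    then show "(f \<longlongrightarrow> f a) (at_right a)"
      using a by (simp add: at_within_Icc_at_right)
    show "\<forall>\<^sub>F s in at_right a. f s = m * s + b"
      using J(2) by eventually_elim (use mb in blast)
    show "\<forall>\<^sub>F s in at_right a. f a < f s"
      using near by eventually_elim (use mono a in \<open>auto simp: strict_mono_on_def\<close>)
  qed
  then show ?thesis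
    using that by blast
qed

text \<open>An order automorphism of \<open>S\<close> that preserves \<open>U\<close> also preserves
  the greatest lower bound of \<open>U\<close>.\<close>

lemma fixes_Inf_of_invariant_set:
  fixes S :: "'a :: conditionally_complete_linorder set"
  assumes x: "bij_betw x S S" "strict_mono_on S x" and U: "U \<subseteq> S" "U \<noteq> {}" "bdd_below U" "Inf U \<in> S"
    and inv: "\<And>t. t \<in> S \<Longrightarrow> x t \<in> U \<longleftrightarrow> t \<in> U"
  shows "x (Inf U) = Inf U"
proof (rule antisym)
  have mono: "x s \<le> x t \<longleftrightarrow> s \<le> t" if "s \<in> S" "t \<in> S" for s t
    using x(2) that by (simp add: strict_mono_on_less_eq)
  have pre: "\<exists>s\<in>S. t = x s" if "t \<in> S" for t
    using x(1) that unfolding bij_betw_def by blast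
  show "x (Inf U) \<le> Inf U"
  proof (rule cInf_greatest[OF U(2)])
    fix u assume u: "u \<in> U"
    then obtain v where v: "v \<in> S" "u = x v"
      using pre U(1) by blast
    then have "Inf U \<le> v"
      using inv u U(3) by (auto intro: cInf_lower)
    then show "x (Inf U) \<le> u"
      using v mono U(4) by simp
  qed
  obtain b where b: "b \<in> S" "Inf U = x b"
    using pre U(4) by blast
  have "b \<le> Inf U"
  proof (rule cInf_greatest[OF U(2)])
    fix u assume u: "u \<in> U"
    then have "x b \<le> x u"
      unfolding b(2)[symmetric] using inv U by (intro cInf_lower) auto
    then show "b \<le> u"
      using mono b(1) u U(1) by auto
  qed
  then show "Inf U \<le> x (Inf U)"
    using b mono U(4) by metis
qed

lemma PL_I_central_commutator:
  assumes xyh: "x \<in> carrier PL_I" "y \<in> carrier PL_I" "h \<in> carrier PL_I"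
    and comm: "\<And>t. t \<in> {0..1} \<Longrightarrow> x (y t) = h (y (x t))"
    and hx: "\<And>t. t \<in> {0..1} \<Longrightarrow> h (x t) = x (h t)" and hy: "\<And>t. t \<in> {0..1} \<Longrightarrow> h (y t) = y (h t)"
    and "t \<in> {0..1}"
  shows "h t = t"
proof (rule ccontr)
  assume "h t \<noteq> t"
  define U where "U = {t \<in> {0..1}. h t \<noteq> t}"
  define a where "a = Inf U"
  have U: "U \<subseteq> {0..1}" "U \<noteq> {}" "bdd_below U"
    using \<open>h t \<noteq> t\<close> \<open>t \<in> {0..1}\<close> by (auto simp: U_def intro: bdd_belowI[of _ 0])
  obtain u where u: "u \<in> U"
    using U by blast
  have le: "a \<le> v" if "v \<in> U" for v
    unfolding a_def using that U by (simp add: cInf_lower)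
  have a0: "0 \<le> a"
    unfolding a_def using U by (intro cInf_greatest) auto
  have a01: "a \<in> {0..1}"
    using a0 le[OF u] u by (auto simp: U_def)
  \<comment> \<open>A map commuting with \<open>h\<close> permutes the points that \<open>h\<close>
    moves. This is applied to \<open>x\<close>, \<open>y\<close> and to \<open>h\<close>
    itself.\<close>
  have fix_a: "f a = a" if f: "f \<in> carrier PL_I" and hf: "\<And>t. t \<in> {0..1} \<Longrightarrow> h (f t) = f (h t)" for f
  proof -
    have "bij_betw f {0..1} {0..1}" "strict_mono_on {0..1} f"
      using f by (auto simp: PL_I_def Bij_def)
    moreover have "f t \<in> U \<longleftrightarrow> t \<in> U" if t: "t \<in> {0..1}" for t
    proof -
      have "h t \<in> {0..1}" "f t \<in> {0..1}"
        using t f xyh(3) by (auto simp: PL_I_def dest!: Bij_imp_funcset)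
      moreover have "inj_on f {0..1}"
        using f by (auto simp: PL_I_def Bij_def bij_betw_def)
      ultimately show ?thesis
        using t by (auto simp: U_def hf inj_on_eq_iff)
    qed
    ultimately show ?thesis
      unfolding a_def using U a01 a_def by (intro fixes_Inf_of_invariant_set) auto
  qed
  have fixed: "x a = a" "y a = a" "h a = a"
    using fix_a xyh hx hy by auto
  then have "a \<notin> U"
    by (simp add: U_def)
  then have a1: "a < 1"
    using le[OF u] u by (cases "a = u") (auto simp: U_def)
  obtain m n l where slopes: "right_slope x a m" "right_slope y a n" "right_slope h a l"
    using PL_I_right_slope xyh a0 a1 by metis
  have "\<forall>\<^sub>F s in at_right a. x (y s) = h (y (x s))"
    using eventually_at_right_real[OF a1] by eventually_elim (use a0 comm in auto)
  then have "l = 1"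
    using right_slope_commutator slopes fixed by blast
  then have "\<forall>\<^sub>F s in at_right a. h s = s"
    using right_slope_one slopes(3) fixed(3) by blast
  \<comment> \<open>No point of \<open>{a<..<c}\<close> is moved, nor is \<open>a\<close>, so the
    infimum of the moved points could not be \<open>a\<close>.\<close>
  then obtain c where "a < c" and c: "\<And>s. a < s \<Longrightarrow> s < c \<Longrightarrow> h s = s"
    unfolding eventually_at_right[OF a1] by auto
  then obtain v where "v \<in> U" "v < c"
    using cInf_lessD[OF U(2)] unfolding a_def by blast
  moreover have "a < v"
    using le[OF \<open>v \<in> U\<close>] \<open>a \<notin> U\<close> \<open>v \<in> U\<close> by (cases "a = v") auto
  ultimately show False
    using c by (auto simp: U_def)
qed

theorem nilpotent_PL_I:
  assumes "subgroup H PL_I" "nilpotent_group (PL_I\<lparr>carrier := H\<rparr>)"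
  shows "comm_group (PL_I\<lparr>carrier := H\<rparr>)"
proof -
  have H: "H \<subseteq> carrier PL_I"
    using assms(1) subgroup.subset by blast
  have eq: "PL_I\<lparr>carrier := H\<rparr> = (BijGroup {0..1})\<lparr>carrier := H\<rparr>"
    by (simp add: PL_I_def)
  show ?thesis
    unfolding eq
  proof (rule nilpotent_comm_group_of_bijections)
    show "H \<subseteq> Bij {0..1}"
      using H by (auto simp: PL_I_def)
    show "nilpotent_group (BijGroup {0..1}\<lparr>carrier := H\<rparr>)"
      using assms(2) eq by simp
  next
    fix x y h and t :: real
    assume "x \<in> H" "y \<in> H" "h \<in> H" "t \<in> {0..1}"
      "\<And>t. t \<in> {0..1} \<Longrightarrow> x (y t) = h (y (x t))"
      "\<And>t. t \<in> {0..1} \<Longrightarrow> h (x t) = x (h t)" "\<And>t. t \<in> {0..1} \<Longrightarrow> h (y t) = y (h t)"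
    then show "h t = t"
      using H by (intro PL_I_central_commutator[of x y h]) auto
  qed
qed

section \<open>Lifts of circle homeomorphisms\<close>

text \<open>These are the lifts of orientation-preserving circle homeomorphisms; surjectivity
  follows from continuity and the last condition.\<close>

definition circle_lift :: "(real \<Rightarrow> real) \<Rightarrow> bool" where
  "circle_lift F \<longleftrightarrow> continuous_on UNIV F \<and> strict_mono F \<and> (\<forall>t. F (t + 1) = F t + 1)"

lemma circle_liftD:
  assumes "circle_lift F"
  shows "continuous_on UNIV F" "strict_mono F" "F (t + 1) = F t + 1"
  using assms unfolding circle_lift_def by auto

lemma circle_lift_add_nat:
  assumes "circle_lift F"
  shows "F (t + of_nat n) = F t + of_nat n"
  using circle_liftD(3)[OF assms, of "t + of_nat _"] by (induction n) (simp_all add: add_ac)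

lemma circle_lift_add_int:
  assumes "circle_lift F"
  shows "F (t + of_int k) = F t + of_int k"
proof (cases k)
  case (nonneg n)
  then show ?thesis
    using circle_lift_add_nat[OF assms, of t n] by simp
next
  case (neg n)
  then have "t - of_nat (Suc n) = t + of_int k"
    by simp
  then show ?thesis
    using circle_lift_add_nat[OF assms, of "t + of_int k" "Suc n"] neg by simp
qed

lemma circle_lift_funpow:
  assumes "circle_lift F"
  shows "circle_lift (F ^^ n)"
proof (induction n)
  case 0
  then show ?case
    by (simp add: circle_lift_def strict_mono_def)
next
  case (Suc n)
  have "continuous_on UNIV (F \<circ> (F ^^ n))"
    using Suc assms by (intro continuous_on_compose) (auto simp: circle_lift_def intro: continuous_on_subset)
  then show ?case
    using Suc assms by (auto simp: circle_lift_def strict_mono_def)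
qed

lemma circle_lift_shift:
  assumes "circle_lift F"
  shows "circle_lift (\<lambda>t. F t + of_int k)"
  using assms by (auto simp: circle_lift_def strict_mono_def intro!: continuous_intros)

lemma circle_lift_translation: "circle_lift (\<lambda>t. t + of_int k)"
  by (auto simp: circle_lift_def strict_mono_def intro!: continuous_intros)

text \<open>The displacements of a lift at any two points differ by less than 1, so both
  \<open>A (B t)\<close> and \<open>B (A t)\<close> are at distance less than 1 from
  \<open>A t + B t - t\<close>.\<close>

lemma circle_lift_commute_bound:
  assumes A: "circle_lift A" and B: "circle_lift B"
  shows "\<bar>A (B t) - B (A t)\<bar> < 2"
proof -
  have *: "F t + of_int \<lfloor>s - t\<rfloor> \<le> F s" "F s < F t + of_int \<lfloor>s - t\<rfloor> + 1" if "circle_lift F" for F s t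
  proof -
    have "F (t + of_int \<lfloor>s - t\<rfloor>) \<le> F s"
      by (rule strict_mono_leD[OF circle_liftD(2)[OF that]]) linarith
    then show "F t + of_int \<lfloor>s - t\<rfloor> \<le> F s"
      by (simp only: circle_lift_add_int[OF that])
    have "F s < F (t + of_int (\<lfloor>s - t\<rfloor> + 1))"
      by (rule strict_monoD[OF circle_liftD(2)[OF that]]) linarith
    then have "F s < F t + of_int (\<lfloor>s - t\<rfloor> + 1)"
      by (simp only: circle_lift_add_int[OF that])
    then show "F s < F t + of_int \<lfloor>s - t\<rfloor> + 1"
      by simp
  qed
  show ?thesis
    using *[OF A, where t = t and s = "B t"] *[OF B, where t = t and s = "A t"] by linarith
qed

section \<open>Commutators of powers and bounded displacement\<close>

lemma funpow_commute:
  assumes "\<And>t. h (x t) = x (h t)"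
  shows "(h ^^ n) (x t) = x ((h ^^ n) t)"
  by (induction n) (simp_all add: assms)

text \<open>Bilinearity of the commutator when \<open>h = [x, y]\<close> commutes with
  \<open>x\<close> and \<open>y\<close>, written without inverses. The case \<open>q = 1\<close>
  comes first, then an induction on \<open>q\<close>.\<close>

lemma funpow_commutator:
  assumes comm: "\<And>t. x (y t) = h (y (x t))"
    and hx: "\<And>t. h (x t) = x (h t)" and hy: "\<And>t. h (y t) = y (h t)"
  shows "(x ^^ p) ((y ^^ q) t) = (h ^^ (p * q)) ((y ^^ q) ((x ^^ p) t))"
proof -
  have *: "(x ^^ p) (y t) = (h ^^ p) (y ((x ^^ p) t))" for t
  proof (induction p)
    case (Suc p)
    then show ?case
      by (simp add: funpow_commute[of h x, OF hx, symmetric] comm funpow_swap1)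
  qed simp
  show ?thesis
  proof (induction q)
    case (Suc q)
    have "(x ^^ p) ((y ^^ Suc q) t) = (h ^^ p) (y ((h ^^ (p * q)) ((y ^^ q) ((x ^^ p) t))))"
      using Suc * by simp
    also have "\<dots> = (h ^^ p) ((h ^^ (p * q)) (y ((y ^^ q) ((x ^^ p) t))))"
      by (simp add: funpow_commute[of h y, OF hy])
    also have "\<dots> = (h ^^ (p * Suc q)) ((y ^^ Suc q) ((x ^^ p) t))"
      by (simp add: funpow_add)
    finally show ?case .
  qed simp
qed

text \<open>\<open>F t - t\<close> is continuous, has period 1 and never vanishes, so it keeps one
  sign and its absolute value has a positive minimum \<open>e\<close>; each iteration adds at least
  \<open>e\<close> in the same direction.\<close>

lemma circle_lift_displacement:
  assumes F: "circle_lift F" and no_fix: "\<And>t. F t \<noteq> t"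
  obtains e where "0 < e" "\<And>n t. of_nat n * e \<le> \<bar>(F ^^ n) t - t\<bar>"
proof -
  \<comment> \<open>The constant sign of the displacement, which treats upward and downward motion
    together.\<close>
  define c where "c = sgn (F 0 - 0)"
  have cont: "continuous_on S (\<lambda>t. F t - t)" for S
    using circle_liftD(1)[OF F] by (intro continuous_intros) (auto intro: continuous_on_subset)
  have "connected (range (\<lambda>t. F t - t))"
    using cont by (intro connected_continuous_image) auto
  moreover have "0 \<notin> range (\<lambda>t. F t - t)"
    using no_fix by (metis (no_types, lifting) eq_iff_diff_eq_0 imageE)
  ultimately have "\<not> (F s - s \<le> 0 \<and> 0 \<le> F t - t)" for s t
    by (meson connectedD_interval rangeI)
  then have pos: "0 < c * (F t - t)" for t
    using no_fix[of 0] no_fix[of t] unfolding c_def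
    by (smt (verit) mult_pos_pos mult_neg_neg sgn_pos sgn_neg)
  have "\<exists>s\<in>{0..1}. \<forall>t\<in>{0..1}. c * (F s - s) \<le> c * (F t - t)"
    using cont by (intro continuous_attains_inf continuous_on_mult_left) auto
  then obtain s where s: "\<And>t. t \<in> {0..1} \<Longrightarrow> c * (F s - s) \<le> c * (F t - t)"
    by blast
  define e where "e = c * (F s - s)"
  have ge: "e \<le> c * (F t - t)" for t
  proof -
    have "F (frac t) - frac t = F t - t"
      using circle_lift_add_int[OF F, of "frac t" "\<lfloor>t\<rfloor>"] by (simp add: frac_def)
    then show ?thesis
      using s[of "frac t"] frac_lt_1[of t] unfolding e_def by (simp add: less_imp_le)
  qed
  have "of_nat n * e \<le> c * ((F ^^ n) t - t)" for n t
  proof (induction n)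
    case (Suc n)
    then show ?case
      using ge[of "(F ^^ n) t"] by (simp add: algebra_simps)
  qed simp
  moreover have "c * r \<le> \<bar>r\<bar>" for r
    unfolding c_def by (simp add: sgn_if abs_if)
  ultimately show ?thesis
    using that[of e] pos[of s] e_def order_trans by blast
qed

text \<open>The displacement of the commutator of the \<open>n\<close>-th powers, which is the \<open>n\<^sup>2\<close>-th power of the
  central commutator, stays bounded; without a fixed point it would grow like \<open>n\<^sup>2\<close>.\<close>

lemma circle_lift_commutator_fixed_point:
  assumes X: "circle_lift X" and Y: "circle_lift Y" and F: "circle_lift F"
    and comm: "\<And>t. X (Y t) = F (Y (X t))"
    and FX: "\<And>t. F (X t) = X (F t)" and FY: "\<And>t. F (Y t) = Y (F t)"
  obtains t where "F t = t"
proof (rule ccontr)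
  assume "\<not> thesis"
  then have "F t \<noteq> t" for t
    using that by blast
  then obtain e where e: "0 < e" "\<And>n t. of_nat n * e \<le> \<bar>(F ^^ n) t - t\<bar>"
    using circle_lift_displacement[OF F] by blast
  obtain n :: nat where n: "2 < of_nat n * e"
    using reals_Archimedean3[OF e(1)] by blast
  have "of_nat n * e \<le> of_nat (n * n) * e"
    using e(1) by (intro mult_right_mono of_nat_mono) auto
  also have "\<dots> \<le> \<bar>(F ^^ (n * n)) ((Y ^^ n) ((X ^^ n) 0)) - (Y ^^ n) ((X ^^ n) 0)\<bar>"
    by (rule e(2))
  also have "\<dots> = \<bar>(X ^^ n) ((Y ^^ n) 0) - (Y ^^ n) ((X ^^ n) 0)\<bar>"
    by (simp add: funpow_commutator[of X Y F, OF comm FX FY])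
  also have "\<dots> < 2"
    using X Y by (intro circle_lift_commute_bound circle_lift_funpow)
  finally show False
    using n by simp
qed

section \<open>Piecewise affine lifts\<close>

text \<open>The pieces cover the line modulo the integers, so finitely many suffice; the formula on
  a piece determines \<open>F\<close> on its translates.\<close>

definition piecewise_affine_lift :: "(real \<Rightarrow> real) \<Rightarrow> bool" where
  "piecewise_affine_lift F \<longleftrightarrow> circle_lift F \<and>
     (\<exists>P. finite P \<and> (\<forall>J\<in>P. is_interval J) \<and> (\<forall>t. \<exists>J\<in>P. \<exists>k::int. t + of_int k \<in> J) \<and>
          (\<forall>J\<in>P. \<exists>a b. \<forall>t\<in>J. F t = a * t + b))"

lemma strict_mono_eventually_at_right:
  fixes F :: "real \<Rightarrow> real"
  assumes "strict_mono F"
  shows "\<forall>\<^sub>F s in at_right a. F a < F s"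
  using eventually_at_right_less[of a] by eventually_elim (use assms in \<open>simp add: strict_monoD\<close>)

lemma finite_int_between: "finite {k::int. (a::real) < of_int k \<and> of_int k < (b::real)}"
  by (rule finite_subset[of _ "{\<lfloor>a\<rfloor>..\<lceil>b\<rceil>}"]) (simp_all, safe, auto simp: le_ceiling_iff floor_le_iff)

text \<open>The integer translates of the pieces cover the line, and only finitely many of their end
  points fall in \<open>{a<..<a + 1}\<close>, so one translate contains all points just to the right
  of \<open>a\<close>.\<close>

lemma piecewise_affine_lift_right_slope:
  assumes "piecewise_affine_lift F"
  obtains m where "right_slope F a m"
proof -
  have F: "circle_lift F"
    using assms unfolding piecewise_affine_lift_def by blast
  obtain P where P: "finite P" "\<forall>J\<in>P. is_interval J" "\<forall>t. \<exists>J\<in>P. \<exists>k::int. t + of_int k \<in> J"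
      "\<forall>J\<in>P. \<exists>m b. \<forall>t\<in>J. F t = m * t + b"
    using assms unfolding piecewise_affine_lift_def by (elim exE conjE)
  define Q where "Q = (\<lambda>(J, k::int). (+) (of_int k) ` J) ` (P \<times> UNIV)"
  obtain K where K: "K \<in> Q" "\<forall>\<^sub>F s in at_right a. s \<in> K"
  proof (rule interval_cover_at_right[of a "a + 1" Q])
    show "is_interval K" if "K \<in> Q" for K
      using that P(2) by (auto simp: Q_def is_interval_translation)
    have "\<exists>K\<in>Q. t \<in> K" for t
    proof -
      obtain J k where "J \<in> P" "t + of_int k \<in> J"
        using P(3) by blast
      then show ?thesis
        unfolding Q_def by (intro bexI[of _ "(+) (of_int (- k)) ` J"]) (auto intro: image_eqI[of _ _ "(J, - k)"] image_eqI[of _ _ "t + of_int k"])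
    qed
    then show "{a<..<a + 1} \<subseteq> \<Union>Q"
      by blast
    have "{a<..<a + 1} \<inter> \<Union>(frontier ` Q) \<subseteq>
        (\<Union>d\<in>\<Union>(frontier ` P). (\<lambda>k. of_int k + d) ` {k::int. a - d < of_int k \<and> of_int k < a + 1 - d})"
      by (fastforce simp: Q_def frontier_translation)
    moreover have "finite (\<Union>d\<in>\<Union>(frontier ` P). (\<lambda>k. of_int k + d) ` {k::int. a - d < of_int k \<and> of_int k < a + 1 - d})"
      using P(1,2) finite_frontier_is_interval finite_int_between by blast
    ultimately show "finite ({a<..<a + 1} \<inter> \<Union>(frontier ` Q))"
      by (rule finite_subset)
  qed auto
  obtain J and k :: int where J: "J \<in> P" "K = (+) (of_int k) ` J"
    using K(1) unfolding Q_def by auto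
  obtain m b where mb: "\<forall>t\<in>J. F t = m * t + b"
    using P(4) J(1) by metis
  have "right_slope F a m"
  proof (rule right_slopeI)
    show "(F \<longlongrightarrow> F a) (at_right a)"
      using circle_liftD(1)[OF F] by (auto simp: continuous_on_def intro: tendsto_within_subset)
    \<comment> \<open>Substitute \<open>t = s - k\<close> in
      \<open>F (t + k) = m * t + b + k\<close>.\<close>
    show "\<forall>\<^sub>F s in at_right a. F s = m * s + (b - m * of_int k + of_int k)"
      using K(2)
    proof eventually_elim
      case (elim s)
      then obtain t where t: "t \<in> J" "s = t + of_int k"
        unfolding J(2) by auto
      then show ?case
        using circle_lift_add_int[OF F, of t k] mb by (simp add: algebra_simps)
    qed
    show "\<forall>\<^sub>F s in at_right a. F a < F s"
      using strict_mono_eventually_at_right circle_liftD(2)[OF F] by blast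
  qed
  then show ?thesis
    using that by blast
qed

lemma piecewise_affine_lift_funpow_right_slope:
  assumes "piecewise_affine_lift F"
  shows "\<exists>m. right_slope (F ^^ n) a m"
proof (induction n)
  case 0
  have "right_slope (F ^^ 0) a 1"
    by (simp add: right_slope_def)
  then show ?case ..
next
  case (Suc n)
  then obtain m where m: "right_slope (F ^^ n) a m"
    by blast
  obtain l where "right_slope F ((F ^^ n) a) l"
    using piecewise_affine_lift_right_slope[OF assms] by blast
  from right_slope_compose[OF m this] show ?case
    by auto
qed

lemma right_slope_funpow:
  assumes "right_slope F a m" "F a = a"
  shows "right_slope (F ^^ n) a (m ^ n) \<and> (F ^^ n) a = a"
proof (induction n)
  case 0
  show ?case
    by (simp add: right_slope_def)
next
  case (Suc n)
  then show ?case
    using right_slope_compose[of "F ^^ n" a "m ^ n" F m] assms by (simp add: mult.commute)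
qed

text \<open>A substitute for the infimum of the moved points, since a circle has no first
  point.\<close>

definition fixed_break :: "(real \<Rightarrow> real) \<Rightarrow> real \<Rightarrow> bool" where
  "fixed_break F a \<longleftrightarrow> F a = a \<and> \<not> (\<forall>\<^sub>F s in at_right a. F s = s)"

text \<open>\<open>X\<close> sends points just right of \<open>a\<close> to points just right of
  \<open>X a\<close>. If \<open>F\<close> were the identity there, commutation and injectivity of
  \<open>X\<close> would pull this back to \<open>a\<close>.\<close>

lemma fixed_break_commuting:
  assumes "fixed_break F a" and X: "circle_lift X" and FX: "\<And>t. F (X t) = X (F t)"
  shows "fixed_break F (X a)"
proof -
  have inj: "X s = X t \<longleftrightarrow> s = t" for s t
    using strict_mono_eq[OF circle_liftD(2)[OF X]] .
  have "(X \<longlongrightarrow> X a) (at_right a)"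
    using circle_liftD(1)[OF X] by (auto simp: continuous_on_def intro: tendsto_within_subset)
  then have lim: "filterlim X (at_right (X a)) (at_right a)"
    using strict_mono_eventually_at_right[OF circle_liftD(2)[OF X], of a]
    by (auto simp: filterlim_at elim: eventually_mono)
  have "\<forall>\<^sub>F s in at_right a. F s = s" if "\<forall>\<^sub>F s in at_right (X a). F s = s"
    using eventually_compose_filterlim[OF that lim] by (simp add: FX inj)
  then show ?thesis
    using assms(1) FX unfolding fixed_break_def by metis
qed

lemma fixed_break_funpow:
  assumes "fixed_break F a" "circle_lift X" "\<And>t. F (X t) = X (F t)"
  shows "fixed_break F ((X ^^ n) a)"
  by (induction n) (use assms fixed_break_commuting in auto)

text \<open>Take the last fixed point between a fixed point and a moved point on its right;
  everything from there up to the moved point is moved.\<close>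

lemma fixed_break_exists:
  assumes F: "circle_lift F" and "F q = q" "F p \<noteq> p"
  obtains a where "fixed_break F a"
proof -
  \<comment> \<open>An integer translate of \<open>p\<close> lying beyond \<open>q\<close>;
    \<open>F\<close> moves it as well.\<close>
  define p' where "p' = p + of_int (\<lceil>q - p\<rceil> + 1)"
  have p': "q < p'" "F p' \<noteq> p'"
    using circle_lift_add_int[OF F, of p "\<lceil>q - p\<rceil> + 1"] \<open>F p \<noteq> p\<close> unfolding p'_def by linarith+
  let ?S = "{q..p'} \<inter> {t. F t = t}"
  have "compact ?S"
    using circle_liftD(1)[OF F] by (intro compact_Int_closed closed_Collect_eq) auto
  moreover have "q \<in> ?S"
    using p' \<open>F q = q\<close> by auto
  ultimately obtain a where a: "a \<in> ?S" "\<And>t. t \<in> ?S \<Longrightarrow> t \<le> a"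
    using compact_attains_sup[of ?S] by (metis empty_iff)
  have "a < p'"
    using a(1) p' by (cases "a = p'") auto
  have "\<forall>\<^sub>F s in at_right a. F s \<noteq> s"
    using eventually_at_right_real[OF \<open>a < p'\<close>] 
  proof eventually_elim
    case (elim s)
    then show ?case
      using a(1) a(2)[of s] by auto
  qed
  then have "\<not> (\<forall>\<^sub>F s in at_right a. F s = s)"
    using eventually_conj trivial_limit_at_right_real[of a] by (fastforce simp: trivial_limit_def elim: eventually_elim2)
  then show ?thesis
    using that a(1) unfolding fixed_break_def by blast
qed

text \<open>A piece contains at most one fixed break: an affine map with two fixed points is the identity.
  Hence the points of the orbit are not all distinct modulo the integers.\<close>

lemma fixed_break_periodic:
  assumes F: "piecewise_affine_lift F" and a: "fixed_break F a" and X: "circle_lift X"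
    and FX: "\<And>t. F (X t) = X (F t)"
  obtains p and k :: int where "0 < p" "(X ^^ p) a = a + of_int k"
proof -
  have cF: "circle_lift F"
    using F unfolding piecewise_affine_lift_def by blast
  obtain P where P: "finite P" "\<forall>J\<in>P. is_interval J" "\<forall>t. \<exists>J\<in>P. \<exists>k::int. t + of_int k \<in> J"
      "\<forall>J\<in>P. \<exists>m b. \<forall>t\<in>J. F t = m * t + b"
    using F unfolding piecewise_affine_lift_def by (elim exE conjE)
  have unique: "\<not> s < t" if J: "J \<in> P" "s \<in> J" "t \<in> J" and st: "fixed_break F s" "F t = t" for J s t
  proof
    assume "s < t"
    obtain m b where mb: "\<forall>t\<in>J. F t = m * t + b"
      using P(4) J(1) by metis
    have "s = m * s + b" "t = m * t + b"
      using mb J st unfolding fixed_break_def by metis+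
    then have "(m - 1) * (t - s) = 0"
      by (simp add: algebra_simps)
    then have "m = 1" "b = 0"
      using \<open>s < t\<close> \<open>s = m * s + b\<close> by auto
    then have "F r = r" if "r \<in> {s<..<t}" for r
      using that mb J P(2) mem_is_interval_1_I[of J s t r] by auto
    then have "\<forall>\<^sub>F r in at_right s. F r = r"
      using eventually_at_right_real[OF \<open>s < t\<close>] by (auto elim: eventually_mono)
    then show False
      using st unfolding fixed_break_def by blast
  qed
  have "\<exists>J (k::int). J \<in> P \<and> (X ^^ n) a + of_int k \<in> J" for n
    using P(3) by blast
  \<comment> \<open>The integer \<open>k n\<close> brings the \<open>n\<close>-th orbit point into
    the piece \<open>J n\<close>.\<close>
  then obtain J and k :: "nat \<Rightarrow> int" where Jk: "\<And>n. J n \<in> P" "\<And>n. (X ^^ n) a + of_int (k n) \<in> J n"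
    by metis
  have break: "fixed_break F ((X ^^ n) a + of_int (k n))" for n
    using fixed_break_commuting[OF fixed_break_funpow[OF a X FX] circle_lift_translation]
      circle_lift_add_int[OF cF] by blast
  have "\<not> inj J"
    using Jk(1) P(1) by (meson finite_subset image_subsetI infinite_UNIV_nat finite_imageD)
  then obtain n n' where n: "n < n'" "J n = J n'"
    by (metis injI linorder_neqE_nat)
  \<comment> \<open>Two breaks in the same piece: \<open>unique\<close> in both orders excludes both
    strict inequalities.\<close>
  have "(X ^^ n) a + of_int (k n) = (X ^^ n') a + of_int (k n')"
    using unique[of "J n"] Jk n(2) break unfolding fixed_break_def by (metis linorder_neqE)
  then have "(X ^^ n) ((X ^^ (n' - n)) a) = (X ^^ n) a + of_int (k n - k n')"
    using n(1) funpow_add[of n "n' - n" X] by simp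
  also have "\<dots> = (X ^^ n) (a + of_int (k n - k n'))"
    by (rule circle_lift_add_int[OF circle_lift_funpow[OF X], symmetric])
  finally have "(X ^^ (n' - n)) a = a + of_int (k n - k n')"
    using strict_mono_eq[OF circle_liftD(2)[OF circle_lift_funpow[OF X]]] by blast
  then show ?thesis
    using that[of "n' - n" "k n - k n'"] n(1) by simp
qed

lemma piecewise_affine_lift_central_commutator:
  assumes X: "piecewise_affine_lift X" and Y: "piecewise_affine_lift Y" and F: "piecewise_affine_lift F"
    and comm: "\<And>t. X (Y t) = F (Y (X t))"
    and FX: "\<And>t. F (X t) = X (F t)" and FY: "\<And>t. F (Y t) = Y (F t)"
  shows "F t = t"
proof (rule ccontr)
  assume "F t \<noteq> t"
  have lifts: "circle_lift X" "circle_lift Y" "circle_lift F"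
    using X Y F unfolding piecewise_affine_lift_def by auto
  obtain q where "F q = q"
    using circle_lift_commutator_fixed_point[OF lifts comm FX FY] by blast
  then obtain a where a: "fixed_break F a"
    using fixed_break_exists[OF lifts(3)] \<open>F t \<noteq> t\<close> by blast
  obtain p and k :: int where p: "0 < p" "(X ^^ p) a = a + of_int k"
    using fixed_break_periodic[OF F a lifts(1) FX] by blast
  obtain r and l :: int where r: "0 < r" "(Y ^^ r) a = a + of_int l"
    using fixed_break_periodic[OF F a lifts(2) FY] by blast
  define A where "A s = (X ^^ p) s + of_int (- k)" for s
  define B where "B s = (Y ^^ r) s + of_int (- l)" for s
  obtain m n where "right_slope (X ^^ p) a m" "right_slope (Y ^^ r) a n"
    using piecewise_affine_lift_funpow_right_slope X Y by metis
  then have AB: "right_slope A a m" "right_slope B a n"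
    unfolding A_def B_def right_slope_def by simp_all
  have ABa: "A a = a" "B a = a"
    using p r by (simp_all add: A_def B_def)
  have Fa: "F a = a"
    using a unfolding fixed_break_def by blast
  obtain u where u: "right_slope F a u"
    using piecewise_affine_lift_right_slope[OF F] by blast
  note Xp = circle_lift_add_int[OF circle_lift_funpow[OF lifts(1)]]
    and Yr = circle_lift_add_int[OF circle_lift_funpow[OF lifts(2)]]
    and Fn = circle_lift_add_int[OF circle_lift_funpow[OF lifts(3)]]
  \<comment> \<open>Integer translations commute with all the lifts, so correcting by them leaves
    the commutator of the powers unchanged.\<close>
  have "A (B s) = (F ^^ (p * r)) (B (A s))" for s
    unfolding A_def B_def Xp Yr Fn using funpow_commutator[of X Y F, OF comm FX FY] by simp
  then have "u ^ (p * r) = 1"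
    using right_slope_commutator[OF AB(1) ABa(1) AB(2) ABa(2), of "F ^^ (p * r)"] right_slope_funpow[OF u Fa] by simp
  moreover have "0 < u"
    using u unfolding right_slope_def by blast
  ultimately have "u = 1"
    using p(1) r(1) by (intro power_eq_imp_eq_base[of u "p * r" 1]) auto
  then show False
    using right_slope_one[of F a] u a unfolding fixed_break_def by blast
qed

section \<open>The circle\<close>

lemma circle_coord_eq_iff: "circle_coord s = circle_coord t \<longleftrightarrow> s - t \<in> \<int>"
proof -
  have "circle_coord s = circle_coord t \<longleftrightarrow> (\<exists>n::int. 2 * pi * s = 2 * pi * t + 2 * pi * of_int n)"
    unfolding circle_coord_def by (auto simp: complex_eq_iff sin_cos_eq_iff[symmetric])
  also have "\<dots> \<longleftrightarrow> (\<exists>n::int. s - t = of_int n)"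
  proof (intro arg_cong[of _ _ Ex] ext)
    fix n :: int
    have "2 * pi * s = 2 * pi * t + 2 * pi * of_int n \<longleftrightarrow> 2 * pi * (s - t) = 2 * pi * of_int n"
      by (simp add: algebra_simps)
    then show "(2 * pi * s = 2 * pi * t + 2 * pi * of_int n) = (s - t = of_int n)"
      by simp
  qed
  finally show ?thesis
    by (auto simp: Ints_def)
qed

lemma circle_coord_in_circle: "circle_coord t \<in> circle"
  by (simp add: circle_coord_def)

lemma circle_coord_surj:
  assumes "z \<in> circle"
  obtains t where "z = circle_coord t"
proof -
  have "z = cis (Arg z)"
    using assms by (metis cis_Arg_unique mem_sphere_0 complex_sgn_def sgn_div_norm scaleR_one inverse_1 cis_Arg norm_zero zero_neq_one)
  also have "\<dots> = circle_coord (Arg z / (2 * pi))"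
    by (simp add: circle_coord_def)
  finally show ?thesis
    using that by blast
qed

lemma continuous_Ints_valued_constant:
  fixes g :: "'a::topological_space \<Rightarrow> real"
  assumes "connected S" "continuous_on S g" "\<And>t. t \<in> S \<Longrightarrow> g t \<in> \<int>"
  obtains k :: int where "\<And>t. t \<in> S \<Longrightarrow> g t = of_int k"
proof -
  have "\<exists>e>0. \<forall>y. y \<in> S \<and> g y \<noteq> g x \<longrightarrow> e \<le> norm (g y - g x)" if x: "x \<in> S" for x
  proof (intro exI[of _ 1] conjI allI impI)
    fix y assume y: "y \<in> S \<and> g y \<noteq> g x"
    then have "g y - g x \<in> \<int>" "g y - g x \<noteq> 0"
      using assms(3) x by auto
    then show "1 \<le> norm (g y - g x)"
      using Ints_nonzero_abs_ge1[of "g y - g x"] by simp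
  qed simp
  then have "g constant_on S"
    by (intro continuous_discrete_range_constant assms(1,2)) blast
  then obtain c where c: "\<And>t. t \<in> S \<Longrightarrow> g t = c"
    unfolding constant_on_def by blast
  \<comment> \<open>If \<open>S\<close> is empty, \<open>c\<close> may be any real, hence the
    floor.\<close>
  show ?thesis
    using that[of "\<lfloor>c\<rfloor>"] c assms(3) by (metis of_int_floor_cancel floor_of_int Ints_cases)
qed

lemma continuous_lifts_differ_by_int:
  fixes F G :: "real \<Rightarrow> real"
  assumes "connected S" "continuous_on S F" "continuous_on S G"
    and "\<And>t. t \<in> S \<Longrightarrow> circle_coord (F t) = circle_coord (G t)"
  obtains k :: int where "\<And>t. t \<in> S \<Longrightarrow> F t = G t + of_int k"
proof -
  obtain k :: int where "\<And>t. t \<in> S \<Longrightarrow> F t - G t = of_int k"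
    by (rule continuous_Ints_valued_constant[of S "\<lambda>t. F t - G t"])
       (use assms in \<open>auto intro: continuous_intros simp: circle_coord_eq_iff\<close>)
  then show ?thesis
    by (intro that[of k]) (simp add: algebra_simps)
qed

text \<open>\<open>F (t + 1) - F t\<close> is a constant integer, the degree. Monotonicity makes it
  positive, and if it exceeded 1, \<open>F\<close> would take the value \<open>F 0 + 1\<close>
  inside the unit interval, against injectivity of \<open>f\<close>.\<close>

lemma circle_lift_of_bijection:
  assumes f: "inj_on f circle" and F: "continuous_on UNIV F" "strict_mono F"
    and lift: "\<And>t. f (circle_coord t) = circle_coord (F t)"
  shows "circle_lift F"
proof -
  have cont: "continuous_on S F" for S
    using F(1) continuous_on_subset by blast
  obtain d :: int where d: "\<And>t. t \<in> UNIV \<Longrightarrow> F (t + 1) = F t + of_int d"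
  proof (rule continuous_lifts_differ_by_int[of UNIV "\<lambda>t. F (t + 1)" F])
    show "continuous_on UNIV (\<lambda>t. F (t + 1))"
      by (intro continuous_on_compose2[OF F(1)] continuous_intros) auto
    show "circle_coord (F (t + 1)) = circle_coord (F t)" for t
      using circle_coord_eq_iff[of "t + 1" t] by (simp flip: lift)
  qed (use F in auto)
  have "F 0 < F (0 + 1)"
    using F(2) by (simp add: strict_monoD)
  then have "0 < d"
    using d[of 0] by simp
  moreover have "\<not> 1 < d"
  proof
    assume "1 < d"
    then have d1: "F 0 + 1 < F 1"
      using d[of 0] by simp
    then obtain s where s: "0 \<le> s" "s \<le> 1" "F s = F 0 + 1"
      using IVT'[of F 0 "F 0 + 1" 1] cont by auto
    then have "0 < s" "s < 1"
      using d1 by (auto simp: less_le)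
    have "f (circle_coord s) = f (circle_coord 0)"
      by (simp add: lift circle_coord_eq_iff s)
    then have "circle_coord s = circle_coord 0"
      using f circle_coord_in_circle by (auto dest: inj_onD)
    then have "s \<in> \<int>"
      by (simp add: circle_coord_eq_iff)
    then show False
      using Ints_nonzero_abs_less1[of s] \<open>0 < s\<close> \<open>s < 1\<close> by auto
  qed
  ultimately have "d = 1"
    by simp
  then show ?thesis
    using F d unfolding circle_lift_def by simp
qed

text \<open>On a piece, \<open>F\<close> and the given affine map lift the same map, so they differ
  by a constant integer, intervals being connected. An arbitrary increasing lift is allowed because
  the lift of \<open>h\<close> is shifted later.\<close>

lemma PL_circle_lift:
  assumes f: "f \<in> carrier PL_circle" and F: "continuous_on UNIV F" "strict_mono F"
    and lift: "\<And>t. f (circle_coord t) = circle_coord (F t)"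
  shows "piecewise_affine_lift F"
proof -
  have "bij_betw f circle circle" and "piecewise_linear_circle f"
    using f by (auto simp: PL_circle_def Bij_def)
  then have cF: "circle_lift F"
    using circle_lift_of_bijection[OF _ F lift] by (auto simp: bij_betw_def)
  obtain P where P: "finite P" "\<forall>J\<in>P. is_interval J" "(\<Union>J\<in>P. circle_coord ` J) = circle"
      "\<forall>J\<in>P. \<exists>a b. \<forall>t\<in>J. f (circle_coord t) = circle_coord (a * t + b)"
    using \<open>piecewise_linear_circle f\<close> unfolding piecewise_linear_circle_def by (elim exE conjE)
  have "\<exists>J\<in>P. \<exists>k::int. t + of_int k \<in> J" for t
  proof -
    obtain J s where J: "J \<in> P" "s \<in> J" "circle_coord s = circle_coord t"
      using P(3) circle_coord_in_circle[of t] by (metis UN_E imageE)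
    then obtain k :: int where "s = t + of_int k"
      by (metis circle_coord_eq_iff Ints_cases add.commute diff_add_cancel)
    then show ?thesis
      using J by blast
  qed
  moreover have "\<exists>a b. \<forall>t\<in>J. F t = a * t + b" if J: "J \<in> P" for J
  proof -
    obtain a b where ab: "\<And>t. t \<in> J \<Longrightarrow> f (circle_coord t) = circle_coord (a * t + b)"
      using P(4) J by metis
    obtain k :: int where "\<And>t. t \<in> J \<Longrightarrow> F t = a * t + b + of_int k"
    proof (rule continuous_lifts_differ_by_int[of J F "\<lambda>t. a * t + b"])
      show "connected J"
        using P(2) J is_interval_connected by blast
      show "continuous_on J F"
        using F(1) continuous_on_subset by blast
      show "continuous_on J (\<lambda>t. a * t + b)"
        by (intro continuous_intros)
    qed (use ab lift in auto)
    then show ?thesis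
      by (intro exI[of _ a] exI[of _ "b + of_int k"]) (simp add: add_ac)
  qed
  ultimately show ?thesis
    using cF P unfolding piecewise_affine_lift_def by blast
qed

lemma PL_circle_lift_exists:
  assumes "f \<in> carrier PL_circle"
  obtains F where "continuous_on UNIV F" "strict_mono F" "\<And>t. f (circle_coord t) = circle_coord (F t)"
    "piecewise_affine_lift F"
proof -
  have "orientation_preserving_circle f"
    using assms by (simp add: PL_circle_def)
  then obtain F where "continuous_on UNIV F" "strict_mono F" "\<And>t. f (circle_coord t) = circle_coord (F t)"
    unfolding orientation_preserving_circle_def by blast
  then show ?thesis
    using that PL_circle_lift[OF assms] by blast
qed

text \<open>The commutator of the two lifts is an integral translation, and it has a fixed point.\<close>

lemma lifts_commute:
  assumes F: "circle_lift F" and X: "circle_lift X"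
    and comm: "\<And>t. circle_coord (F (X t)) = circle_coord (X (F t))"
  shows "F (X t) = X (F t)"
proof -
  have cont: "continuous_on S F" "continuous_on S X" for S
    using F X continuous_on_subset unfolding circle_lift_def by blast+
  obtain k :: int where k: "\<And>t. t \<in> UNIV \<Longrightarrow> F (X t) = X (F t) + of_int k"
    by (rule continuous_lifts_differ_by_int[of UNIV "\<lambda>t. F (X t)" "\<lambda>t. X (F t)"])
       (use comm cont in \<open>auto intro: continuous_on_compose2\<close>)
  obtain s :: real where "s + of_int k = s"
    by (rule circle_lift_commutator_fixed_point[OF F X circle_lift_translation[of k]])
       (use k circle_lift_add_int[OF F] circle_lift_add_int[OF X] in auto)
  then show ?thesis
    using k by simp
qed

lemma PL_circle_central_commutator:
  assumes xyh: "x \<in> carrier PL_circle" "y \<in> carrier PL_circle" "h \<in> carrier PL_circle"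
    and comm: "\<And>z. z \<in> circle \<Longrightarrow> x (y z) = h (y (x z))"
    and hx: "\<And>z. z \<in> circle \<Longrightarrow> h (x z) = x (h z)" and hy: "\<And>z. z \<in> circle \<Longrightarrow> h (y z) = y (h z)"
    and "z \<in> circle"
  shows "h z = z"
proof -
  obtain X where X: "\<And>t. x (circle_coord t) = circle_coord (X t)" "piecewise_affine_lift X"
    using PL_circle_lift_exists[OF xyh(1)] by metis
  obtain Y where Y: "\<And>t. y (circle_coord t) = circle_coord (Y t)" "piecewise_affine_lift Y"
    using PL_circle_lift_exists[OF xyh(2)] by metis
  obtain F0 where F0: "\<And>t. h (circle_coord t) = circle_coord (F0 t)" "piecewise_affine_lift F0"
    using PL_circle_lift_exists[OF xyh(3)] by metis
  have lifts: "circle_lift X" "circle_lift Y" "circle_lift F0"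
    using X Y F0 unfolding piecewise_affine_lift_def by auto
  then have cont: "continuous_on S X" "continuous_on S Y" "continuous_on S F0" for S
    using continuous_on_subset unfolding circle_lift_def by blast+
  obtain k :: int where k: "\<And>t. t \<in> UNIV \<Longrightarrow> X (Y t) = F0 (Y (X t)) + of_int k"
  proof (rule continuous_lifts_differ_by_int[of UNIV "\<lambda>t. X (Y t)" "\<lambda>t. F0 (Y (X t))"])
    show "continuous_on UNIV (\<lambda>t. X (Y t))" "continuous_on UNIV (\<lambda>t. F0 (Y (X t)))"
      by (auto intro!: continuous_on_compose2[OF cont(1)] continuous_on_compose2[OF cont(2)]
          continuous_on_compose2[OF cont(3)] cont)
    show "circle_coord (X (Y t)) = circle_coord (F0 (Y (X t)))" for t
      using comm[OF circle_coord_in_circle, of t] by (simp add: X Y F0)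
  qed auto
  \<comment> \<open>The integer by which the relation fails for the lifts is absorbed:
    \<open>F\<close> is again a lift of \<open>h\<close>, and the relation becomes exact.\<close>
  define F where "F t = F0 t + of_int k" for t
  have F_lift: "h (circle_coord t) = circle_coord (F t)" for t
    by (simp add: F0 F_def circle_coord_eq_iff)
  have cF: "circle_lift F"
    unfolding F_def using lifts(3) by (rule circle_lift_shift)
  have F: "piecewise_affine_lift F"
    using PL_circle_lift[OF xyh(3)] cF F_lift unfolding circle_lift_def by blast
  have "F (X t) = X (F t)" for t
    using hx[OF circle_coord_in_circle] by (intro lifts_commute cF lifts) (simp add: X F_lift)
  moreover have "F (Y t) = Y (F t)" for t
    using hy[OF circle_coord_in_circle] by (intro lifts_commute cF lifts) (simp add: Y F_lift)
  moreover have "X (Y t) = F (Y (X t))" for t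
    using k by (simp add: F_def)
  ultimately have "F t = t" for t
    using piecewise_affine_lift_central_commutator[OF X(2) Y(2) F] by blast
  then show ?thesis
    using \<open>z \<in> circle\<close> F_lift by (metis circle_coord_surj)
qed

theorem nilpotent_PL_circle:
  assumes "subgroup H PL_circle" "nilpotent_group (PL_circle\<lparr>carrier := H\<rparr>)"
  shows "comm_group (PL_circle\<lparr>carrier := H\<rparr>)"
proof -
  have H: "H \<subseteq> carrier PL_circle"
    using assms(1) subgroup.subset by blast
  have eq: "PL_circle\<lparr>carrier := H\<rparr> = (BijGroup circle)\<lparr>carrier := H\<rparr>"
    by (simp add: PL_circle_def)
  show ?thesis
    unfolding eq
  proof (rule nilpotent_comm_group_of_bijections)
    show "H \<subseteq> Bij circle"
      using H by (auto simp: PL_circle_def)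
    show "nilpotent_group (BijGroup circle\<lparr>carrier := H\<rparr>)"
      using assms(2) eq by simp
  next
    fix x y h and z :: complex
    assume "x \<in> H" "y \<in> H" "h \<in> H" "z \<in> circle"
      "\<And>z. z \<in> circle \<Longrightarrow> x (y z) = h (y (x z))"
      "\<And>z. z \<in> circle \<Longrightarrow> h (x z) = x (h z)" "\<And>z. z \<in> circle \<Longrightarrow> h (y z) = y (h z)"
    then show "h z = z"
      using H by (intro PL_circle_central_commutator[of x y h]) auto
  qed
qed

theorem theorem4p1:
  shows "(\<forall>H. subgroup H PL_I \<and> nilpotent_group (PL_I\<lparr>carrier := H\<rparr>)
              \<longrightarrow> comm_group (PL_I\<lparr>carrier := H\<rparr>)) \<and>
         (\<forall>H. subgroup H PL_circle \<and> nilpotent_group (PL_circle\<lparr>carrier := H\<rparr>)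
              \<longrightarrow> comm_group (PL_circle\<lparr>carrier := H\<rparr>))"
  using nilpotent_PL_I nilpotent_PL_circle by blast

end
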